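(* For every integer $n\geqslant 4$, the $4$-component connectivity of the $n$-dimensional alternating group network satisfies $\kappa_4(AN_n)=3n-6$.
   Context: Let $\mathbb{Z}_n=\{1,2,\ldots,n\}$ and let $A_n$ be the set of even permutations of $\mathbb{Z}_n$, written as strings $p=(p_1p_2\cdots p_n)$. For $n\geqslant 3$ the alternating group network $AN_n$ is the graph with vertex set $A_n$ in which $p=(p_1\cdots p_n)$ and $q=(q_1\cdots q_n)$ are adjacent if and only if one of the following holds: (i) $p_1=q_2$, $p_2=q_3$, $p_3=q_1$ and $p_j=q_j$ for all $j\notin\{1,2,3\}$; (ii) $p_1=q_3$, $p_2=q_1$, $p_3=q_2$ and $p_j=q_j$ for all $j\notin\{1,2,3\}$; (iii) there is $i\in\{4,\ldots,n\}$ with $p_1=q_2$, $p_2=q_1$, $p_3=q_i$, $p_i=q_3$ and $p_j=q_j$ for all $j\notin\{1,2,3,i\}$. For a graph $G$ and an integer $\ell\geqslant 2$, the $\ell$-component connectivity $\kappa_\ell(G)$ is the minimum number of vertices whose removal from $G$ results in a disconnected graph with at least $\ell$ components or a graph with fewer than $\ell$ vertices. *)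

theory Defs
  imports "Graph_Theory.Graph_Theory" "HOL-Combinatorics.Permutations"
begin

(* A simple undirected graph is a finite loopfree symmetric digraph (locale pair_graph), so its
   connected components are its strongly connected components.  The string (p_1 ... p_n) is
   represented by the function p with p j = p_j for j in {1..n} and p j = j elsewhere. *)

definition even_perms :: "nat \<Rightarrow> (nat \<Rightarrow> nat) set" where
  "even_perms n = {p. p permutes {1..n} \<and> evenperm p}"

definition AN_adj :: "nat \<Rightarrow> (nat \<Rightarrow> nat) \<Rightarrow> (nat \<Rightarrow> nat) \<Rightarrow> bool" where
  "AN_adj n p q \<longleftrightarrow>
     (p 1 = q 2 \<and> p 2 = q 3 \<and> p 3 = q 1 \<and> (\<forall>j\<in>{1..n} - {1, 2, 3}. p j = q j)) \<or>
     (p 1 = q 3 \<and> p 2 = q 1 \<and> p 3 = q 2 \<and> (\<forall>j\<in>{1..n} - {1, 2, 3}. p j = q j)) \<or>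
     (\<exists>i\<in>{4..n}. p 1 = q 2 \<and> p 2 = q 1 \<and> p 3 = q i \<and> p i = q 3 \<and>
        (\<forall>j\<in>{1..n} - {1, 2, 3, i}. p j = q j))"

(* Meaningful for n \<ge> 3 only. *)
definition AN :: "nat \<Rightarrow> (nat \<Rightarrow> nat) pair_pre_digraph" where
  "AN n = \<lparr> pverts = even_perms n,
            parcs = {(p, q). p \<in> even_perms n \<and> q \<in> even_perms n \<and> AN_adj n p q} \<rparr>"

lemma pair_graph_AN:
  assumes "n \<ge> 3"
  shows "pair_graph (AN n)"
proof -
  have fin: "finite (even_perms n)"
    by (rule finite_subset[OF _ finite_permutations[of "{1..n}"]]) (auto simp: even_perms_def)
  have adj_sym: "AN_adj n q p" if "AN_adj n p q" for p q
    using that unfolding AN_adj_def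
  proof (elim disjE bexE conjE, goal_cases)
    case 1
    then show ?case by (intro disjI2 disjI1) simp
  next
    case 2
    then show ?case by (intro disjI1) simp
  next
    case (3 i)
    then show ?case by (intro disjI2 bexI[of _ i]) simp_all
  qed
  have loopfree: "\<not> AN_adj n p p" if "p \<in> even_perms n" for p
  proof -
    have "inj p"
      using that by (auto simp: even_perms_def dest: permutes_inj)
    then have "p 1 \<noteq> p 2" "p 1 \<noteq> p 3"
      by (simp_all add: inj_eq)
    then show ?thesis
      unfolding AN_adj_def by metis
  qed
  have fin_arcs: "finite (parcs (AN n))"
    by (rule finite_subset[of _ "even_perms n \<times> even_perms n"]) (auto simp: AN_def fin)
  show ?thesis
  proof unfold_locales
    show "symmetric (with_proj (AN n))"
      using adj_sym by (simp add: AN_def symmetric_def sym_def)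
    show "fst e \<noteq> snd e" if "e \<in> parcs (AN n)" for e
      using that loopfree by (cases e) (auto simp: AN_def)
  qed (use fin in \<open>auto simp: AN_def intro: fin_arcs[unfolded AN_def, simplified]\<close>)
qed

(* Intended for finite symmetric digraphs G and l \<ge> 2; the minimum exists since S = verts G
   leaves no vertices. *)
definition component_connectivity :: "nat \<Rightarrow> ('a, 'b) pre_digraph \<Rightarrow> nat" where
  "component_connectivity l G =
     (LEAST k. \<exists>S. S \<subseteq> verts G \<and> finite S \<and> card S = k \<and>
        (\<not> Digraph_Component.connected (G \<restriction> (verts G - S)) \<and>
           l \<le> card (pre_digraph.sccs (G \<restriction> (verts G - S))) \<or>
         card (verts (G \<restriction> (verts G - S))) < l))"

end

theory Submission
  imports Defs
begin

text \<open>The network is the Cayley graph of the alternating group for the generators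
  $(1\;2)(3\;j)$, $j \ne 3$ (for $j \le 2$ these are the two rotations of the first three
  positions). Fixing the last symbol splits it into $n$ copies of the network of dimension
  $n - 1$; every vertex has exactly one neighbour outside its copy, and any two copies are joined by
  $(n-2)!/2$ disjoint edges.

  For the lower bound one shows simultaneously by induction on $n$ that deleting at most $n - 2$,
  $2n - 4$, $3n - 7$ vertices leaves at most 1, 2, 3 components. A copy is bad if at least $n - 2$ of
  its vertices are deleted; there are at most two bad copies. The other copies are connected by the
  induction hypothesis and, as there are many edges between copies, they lie in a single component.
  Any further component lives in the bad copies, where the induction hypothesis and the number of
  vertices deleted elsewhere bound how many there can be. For the upper bound, isolate three
  alternate vertices of a hexagon.\<close>

subsection \<open>The network as a Cayley graph\<close>

definition gen :: "nat \<Rightarrow> nat \<Rightarrow> nat" where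
  "gen j = Transposition.transpose 3 j \<circ> Transposition.transpose 1 2"

text \<open>The index 3 is left out because \<open>gen 3\<close> would be the single transposition
  (1 2), which is odd.\<close>

definition gens :: "nat \<Rightarrow> nat set" where
  "gens n = {1..n} - {3}"

lemma gen_3 [simp]: "gen j 3 = j"
  by (simp add: gen_def)

lemma gen_1_neq: "j \<noteq> 3 \<Longrightarrow> gen j (Suc 0) \<noteq> Suc 0"
  by (simp add: gen_def Transposition.transpose_def)

lemma even_perms_permutes: "p \<in> even_perms n \<Longrightarrow> p permutes {1..n}"
  by (simp add: even_perms_def)

lemma even_perms_inj: "p \<in> even_perms n \<Longrightarrow> inj p"
  by (metis even_perms_permutes permutes_inj)

lemma finite_even_perms [simp]: "finite (even_perms n)"
  by (rule finite_subset[OF _ finite_permutations[of "{1..n}"]]) (auto simp: even_perms_def)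

lemma even_perms_comp: "p \<in> even_perms n \<Longrightarrow> q \<in> even_perms n \<Longrightarrow> p \<circ> q \<in> even_perms n"
  by (auto simp: even_perms_def evenperm_comp intro: permutes_compose)
    (metis evenperm_comp finite_atLeastAtMost permutation_permutes)

lemma even_perms_inv: "p \<in> even_perms n \<Longrightarrow> inv p \<in> even_perms n"
  by (auto simp: even_perms_def intro: permutes_inv)
    (metis evenperm_inv finite_atLeastAtMost permutation_permutes)

lemma id_in_even_perms [simp]: "id \<in> even_perms n"
  by (simp add: even_perms_def permutes_id)

lemma even_perms_mono: "m \<le> n \<Longrightarrow> even_perms m \<subseteq> even_perms n"
  by (auto simp: even_perms_def intro: permutes_subset)

lemma swap_swap_in_even_perms:
  assumes "{a, b, c, d} \<subseteq> {1..n}" "a \<noteq> b" "c \<noteq> d"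
  shows "Transposition.transpose a b \<circ> Transposition.transpose c d \<in> even_perms n"
proof -
  have "Transposition.transpose a b permutes {1..n}" "Transposition.transpose c d permutes {1..n}"
    using assms by (auto intro: permutes_swap_id)
  then show ?thesis
    using assms by (auto simp: even_perms_def evenperm_comp evenperm_swap permutation_swap_id
        intro: permutes_compose)
qed

lemma gen_in_even_perms: "n \<ge> 3 \<Longrightarrow> j \<in> gens n \<Longrightarrow> gen j \<in> even_perms n"
  unfolding gen_def gens_def by (rule swap_swap_in_even_perms) auto

lemma comp_gen_in_even_perms:
  "n \<ge> 3 \<Longrightarrow> p \<in> even_perms n \<Longrightarrow> j \<in> gens n \<Longrightarrow> p \<circ> gen j \<in> even_perms n"
  by (simp add: even_perms_comp gen_in_even_perms)

text \<open>Right multiplication by \<open>gen j\<close> permutes positions and moves none except 1,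
  2, 3 and \<open>j\<close>. Rules (i), (ii) and (iii) of adjacency correspond to
  \<open>gen 2\<close>, \<open>gen 1\<close> and \<open>gen i\<close> with \<open>i\<close> at least
  4.\<close>

lemma AN_adj_iff_gen:
  assumes "n \<ge> 3" and p: "p \<in> even_perms n" and q: "q \<in> even_perms n"
  shows "AN_adj n p q \<longleftrightarrow> (\<exists>j\<in>gens n. q = p \<circ> gen j)"
proof -
  have eq: "q = p \<circ> gen j \<longleftrightarrow> (\<forall>k\<in>{1..n}. q k = p (gen j k))" if "j \<in> gens n" for j
  proof
    assume *: "\<forall>k\<in>{1..n}. q k = p (gen j k)"
    have pg: "p \<circ> gen j \<in> even_perms n"
      using comp_gen_in_even_perms that assms by blast
    show "q = p \<circ> gen j"
    proof
      fix k show "q k = (p \<circ> gen j) k"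
        using * permutes_not_in[OF even_perms_permutes[OF pg], of k]
          permutes_not_in[OF even_perms_permutes[OF q], of k] by (cases "k \<in> {1..n}") auto
    qed
  qed auto
  have eq': "q = p \<circ> gen j \<longleftrightarrow> (\<forall>k\<in>B. q k = p (gen j k)) \<and> (\<forall>k\<in>{1..n} - B. p k = q k)"
    if "j \<in> gens n" "B \<subseteq> {1..n}" "{1, 2, 3, j} \<subseteq> B" for j B
  proof -
    have "gen j k = k" if "k \<notin> B" for k
      using that \<open>{1, 2, 3, j} \<subseteq> B\<close> by (auto simp: gen_def Transposition.transpose_def)
    with eq[OF that(1)] that(2) show ?thesis by (metis DiffD1 DiffD2 DiffI subsetD)
  qed
  have B: "{1, 2, 3} \<subseteq> {1..n}" using \<open>n \<ge> 3\<close> by auto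
  have g1: "q = p \<circ> gen 1 \<longleftrightarrow>
      p 1 = q 3 \<and> p 2 = q 1 \<and> p 3 = q 2 \<and> (\<forall>j\<in>{1..n} - {1, 2, 3}. p j = q j)"
  proof -
    have 1: "gen 1 1 = 2" "gen 1 2 = 3" "gen 1 3 = 1"
      by (auto simp: gen_def Transposition.transpose_def)
    have "1 \<in> gens n" using \<open>n \<ge> 3\<close> by (simp add: gens_def)
    from eq'[OF this B] show ?thesis unfolding ball_simps 1 by auto
  qed
  have g2: "q = p \<circ> gen 2 \<longleftrightarrow>
      p 1 = q 2 \<and> p 2 = q 3 \<and> p 3 = q 1 \<and> (\<forall>j\<in>{1..n} - {1, 2, 3}. p j = q j)"
  proof -
    have 1: "gen 2 1 = 3" "gen 2 2 = 1" "gen 2 3 = 2"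
      by (auto simp: gen_def Transposition.transpose_def)
    have "2 \<in> gens n" using \<open>n \<ge> 3\<close> by (simp add: gens_def)
    from eq'[OF this B] show ?thesis unfolding ball_simps 1 by auto
  qed
  have gi: "q = p \<circ> gen i \<longleftrightarrow> p 1 = q 2 \<and> p 2 = q 1 \<and> p 3 = q i \<and> p i = q 3 \<and>
        (\<forall>j\<in>{1..n} - {1, 2, 3, i}. p j = q j)" if i: "i \<in> {4..n}" for i
  proof -
    have 1: "gen i 1 = 2" "gen i 2 = 1" "gen i 3 = i" "gen i i = 3"
      using i by (auto simp: gen_def Transposition.transpose_def)
    have "i \<in> gens n" "{1, 2, 3, i} \<subseteq> {1..n}" using i by (auto simp: gens_def)
    from eq'[OF this] show ?thesis unfolding ball_simps 1 by auto
  qed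
  have "gens n = {1, 2} \<union> {4..n}"
    using \<open>n \<ge> 3\<close> by (auto simp: gens_def)
  moreover have "(\<exists>i\<in>{4..n}. p 1 = q 2 \<and> p 2 = q 1 \<and> p 3 = q i \<and> p i = q 3 \<and>
        (\<forall>j\<in>{1..n} - {1, 2, 3, i}. p j = q j)) \<longleftrightarrow> (\<exists>i\<in>{4..n}. q = p \<circ> gen i)"
    by (rule bex_cong[OF refl]) (rule gi[symmetric])
  ultimately show ?thesis
    unfolding AN_adj_def g1[symmetric] g2[symmetric] by auto
qed

subsection \<open>Copies of the smaller network\<close>

definition copy :: "nat \<Rightarrow> nat \<Rightarrow> (nat \<Rightarrow> nat) set" where
  "copy n i = {p \<in> even_perms n. p n = i}"

text \<open>For n \<ge> 4, \<open>gen n\<close> interchanges the entries at positions 3 and n, so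
  these are the ends in copy \<open>i\<close> of the edges leading to copy \<open>j\<close>.\<close>

definition block :: "nat \<Rightarrow> nat \<Rightarrow> nat \<Rightarrow> (nat \<Rightarrow> nat) set" where
  "block n i j = {p \<in> even_perms n. p n = i \<and> p 3 = j}"

definition cross :: "nat \<Rightarrow> (nat \<Rightarrow> nat) \<Rightarrow> nat \<Rightarrow> nat" where
  "cross n p = p \<circ> gen n"

lemma cross_cross: "n \<ge> 4 \<Longrightarrow> cross n (cross n p) = p"
  by (rule ext) (auto simp: cross_def gen_def Transposition.transpose_def)

lemma cross_in_even_perms: "n \<ge> 4 \<Longrightarrow> p \<in> even_perms n \<Longrightarrow> cross n p \<in> even_perms n"
  by (simp add: cross_def comp_gen_in_even_perms gens_def)

lemma cross_n: "n \<ge> 4 \<Longrightarrow> cross n p n = p 3"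
  by (simp add: cross_def gen_def Transposition.transpose_def)

lemma cross_3: "cross n p 3 = p n"
  by (simp add: cross_def)

lemma even_perms_range: "p \<in> even_perms n \<Longrightarrow> k \<in> {1..n} \<Longrightarrow> p k \<in> {1..n}"
  by (metis even_perms_permutes permutes_in_image)

lemma even_perms_neq: "p \<in> even_perms n \<Longrightarrow> k \<noteq> l \<Longrightarrow> p k \<noteq> p l"
  by (metis even_perms_inj inj_eq)

section \<open>Counting the edges between copies\<close>

lemma block_nonempty:
  assumes "n \<ge> 4" "i \<in> {1..n}" "j \<in> {1..n}" "i \<noteq> j"
  shows "block n i j \<noteq> {}"
proof -
  let ?t = "Transposition.transpose :: nat \<Rightarrow> _"
  \<comment> \<open>\<open>k\<close> is the preimage of \<open>j\<close> under (n i), so that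
    \<open>p\<close> below takes n to \<open>i\<close> and 3 to \<open>j\<close>; since
    \<open>i\<close> and \<open>j\<close> differ, \<open>k\<close> is not n.\<close>
  define k where "k = ?t n i j"
  have k: "k \<in> {1..n}" "k \<noteq> n"
    using assms by (auto simp: k_def Transposition.transpose_def)
  define p where "p = ?t n i \<circ> ?t 3 k"
  have p: "p permutes {1..n}" unfolding p_def
    using assms k by (intro permutes_compose permutes_swap_id) auto
  have pn: "p n = i" "p 3 = j"
    using assms k by (auto simp: p_def Transposition.transpose_def k_def)
  show ?thesis
  proof (cases "evenperm p")
    case True
    then have "p \<in> block n i j" using p pn by (simp add: block_def even_perms_def)
    then show ?thesis by blast
  next
    case False
    \<comment> \<open>Swapping positions 1 and 2 corrects the parity without touching positions 3
      and n.\<close>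
    have "?t 1 2 permutes {1..n}" using \<open>n \<ge> 4\<close> by (intro permutes_swap_id) auto
    then have "p \<circ> ?t 1 2 permutes {1..n}" using p permutes_compose by blast
    moreover have "permutation p" using p permutation_permutes by blast
    then have "evenperm (p \<circ> ?t 1 2)"
      using False by (simp add: evenperm_comp permutation_swap_id evenperm_swap)
    moreover have "(p \<circ> ?t 1 2) n = i" "(p \<circ> ?t 1 2) 3 = j"
      using pn \<open>n \<ge> 4\<close> by (auto simp: Transposition.transpose_def)
    ultimately have "p \<circ> ?t 1 2 \<in> block n i j" by (simp add: block_def even_perms_def)
    then show ?thesis by blast
  qed
qed

text \<open>The exact size of a block is half of \<^term>\<open>fact (n - 2) :: nat\<close>; the following bound suffices.\<close>

definition block_bound :: "nat \<Rightarrow> nat" where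
  "block_bound n = (if n = 4 then 1 else 3)"

lemma finite_block [simp]: "finite (block n i j)"
  by (simp add: block_def)

lemma finite_copy [simp]: "finite (copy n i)"
  by (simp add: copy_def)

text \<open>For n \<ge> 5 a three-cycle on positions 1, 2, 4 leaves positions 3 and n alone, so its
  powers turn one member of the block into three. For n = 4 position 4 is the last one, and only
  nonemptiness is used.\<close>

lemma card_block:
  assumes "n \<ge> 4" "i \<in> {1..n}" "j \<in> {1..n}" "i \<noteq> j"
  shows "block_bound n \<le> card (block n i j)"
proof (cases "n = 4")
  case True
  then show ?thesis using block_nonempty[OF assms]
    by (simp add: block_bound_def Suc_le_eq card_gt_0_iff)
next
  case False
  let ?t = "Transposition.transpose :: nat \<Rightarrow> _"
  define c where "c = ?t 1 2 \<circ> ?t 2 4"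
  obtain p where p: "p \<in> block n i j" using block_nonempty[OF assms] by blast
  have "c \<in> even_perms n"
    unfolding c_def using assms(1) by (intro swap_swap_in_even_perms) auto
  moreover have c: "c n = n" "c 3 = 3" "c 1 = 2" "c 2 = 4"
    using False assms(1) by (auto simp: c_def Transposition.transpose_def)
  ultimately have "{p, p \<circ> c, p \<circ> c \<circ> c} \<subseteq> block n i j"
    using p by (auto simp: block_def even_perms_comp)
  moreover have "p 1 \<noteq> p 2" "p 1 \<noteq> p 4" "p 2 \<noteq> p 4"
    using p by (auto simp: block_def even_perms_neq)
  with c have "p \<noteq> p \<circ> c" "p \<noteq> p \<circ> c \<circ> c" "p \<circ> c \<noteq> p \<circ> c \<circ> c"
    by (metis comp_apply)+
  then have "card {p, p \<circ> c, p \<circ> c \<circ> c} = 3" by simp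
  ultimately have "3 \<le> card (block n i j)" by (metis card_mono finite_block)
  then show ?thesis by (simp add: block_bound_def False)
qed

lemma card_UN_block:
  assumes n: "n \<ge> 4" and P: "P \<subseteq> {1..n} \<times> {1..n}" "\<And>i. (i, i) \<notin> P"
  shows "card P * block_bound n \<le> card {p \<in> even_perms n. (p n, p 3) \<in> P}"
proof -
  have fin: "finite P" using P(1) finite_subset by blast
  have "{p \<in> even_perms n. (p n, p 3) \<in> P} = (\<Union>x\<in>P. block n (fst x) (snd x))"
    by (auto simp: block_def)
  moreover have "card (\<Union>x\<in>P. block n (fst x) (snd x)) = (\<Sum>x\<in>P. card (block n (fst x) (snd x)))"
    by (rule card_UN_disjoint) (auto simp: fin block_def)
  moreover have "(\<Sum>x\<in>P. block_bound n) \<le> (\<Sum>x\<in>P. card (block n (fst x) (snd x)))"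
  proof (rule sum_mono)
    fix x assume "x \<in> P"
    then show "block_bound n \<le> card (block n (fst x) (snd x))"
      using P by (cases x) (auto intro!: card_block n)
  qed
  ultimately show ?thesis by simp
qed

text \<open>Components are counted by colourings of the vertices outside \<^term>\<open>S\<close> that are constant
  along edges: there are at most \<^term>\<open>k\<close> components iff every such colouring uses at most
  \<^term>\<open>k\<close> colours. This avoids walks and passes directly to the copies.\<close>

definition locally_constant :: "nat \<Rightarrow> (nat \<Rightarrow> nat) set \<Rightarrow> ((nat \<Rightarrow> nat) \<Rightarrow> 'c) \<Rightarrow> bool" where
  "locally_constant n S f \<longleftrightarrow>
     (\<forall>p\<in>even_perms n - S. \<forall>j\<in>gens n. p \<circ> gen j \<notin> S \<longrightarrow> f (p \<circ> gen j) = f p)"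

section \<open>Restricting colourings to copies and comparing copies\<close>

lemma locally_constant_cross:
  "locally_constant n S f \<Longrightarrow> n \<ge> 4 \<Longrightarrow> p \<in> even_perms n \<Longrightarrow> p \<notin> S \<Longrightarrow> cross n p \<notin> S \<Longrightarrow>
    f (cross n p) = f p"
  by (auto simp: locally_constant_def cross_def gens_def)

text \<open>A copy is a left coset of the subgroup fixing the last position, and that subgroup is
  the alternating group of degree \<open>m\<close>.\<close>

lemma copy_eq_image:
  assumes g: "g \<in> copy (Suc m) i"
  shows "copy (Suc m) i = (\<lambda>q. g \<circ> q) ` even_perms m"
proof (intro equalityI subsetI)
  fix p assume p: "p \<in> copy (Suc m) i"
  have gE: "g \<in> even_perms (Suc m)" using g by (simp add: copy_def)
  have bij: "bij g" using gE even_perms_permutes permutes_bij by blast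
  define q where "q = inv g \<circ> p"
  have "q \<in> even_perms (Suc m)"
    unfolding q_def using gE p by (auto simp: copy_def intro: even_perms_comp even_perms_inv)
  moreover have "q (Suc m) = Suc m"
    using g p bij by (metis (mono_tags) bij_inv_eq_iff comp_apply copy_def mem_Collect_eq q_def)
  ultimately have "q \<in> even_perms m"
    using permutes_superset[of q "{1..Suc m}" "{1..m}"] by (auto simp: even_perms_def le_Suc_eq)
  moreover have "p = g \<circ> q"
    using bij by (simp add: q_def fun_eq_iff bij_is_surj surj_f_inv_f)
  ultimately show "p \<in> (\<lambda>q. g \<circ> q) ` even_perms m" by blast
next
  fix p assume "p \<in> (\<lambda>q. g \<circ> q) ` even_perms m"
  then obtain q where q: "q \<in> even_perms m" "p = g \<circ> q" by blast
  have "q (Suc m) = Suc m"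
    using permutes_not_in[OF even_perms_permutes[OF q(1)], of "Suc m"] by simp
  moreover have "q \<in> even_perms (Suc m)" using q(1) even_perms_mono[of m "Suc m"] by auto
  ultimately show "p \<in> copy (Suc m) i"
    using g q(2) by (auto simp: copy_def even_perms_comp)
qed

lemma copy_nonempty:
  assumes "n \<ge> 4" "i \<in> {1..n}"
  shows "copy n i \<noteq> {}"
proof -
  obtain j where "j \<in> {1..n}" "i \<noteq> j"
    using assms by (metis One_nat_def atLeastAtMost_iff le_refl not_less_eq_eq numeral_le_one_iff
        order.trans semiring_norm(69))
  with block_nonempty[OF assms(1,2)] show ?thesis by (fastforce simp: block_def copy_def)
qed

text \<open>Left multiplication by \<open>g\<close> commutes with right multiplication by
  generators. Pulling back along it therefore makes the copy an instance of dimension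
  \<open>m\<close> with the same number of deletions and the same colours.\<close>

lemma locally_constant_restrict_copy:
  assumes "m \<ge> 3" "i \<in> {1..Suc m}" and f: "locally_constant (Suc m) S f"
  obtains S' f' where "S' \<subseteq> even_perms m" "locally_constant m S' f'"
    "card S' = card (S \<inter> copy (Suc m) i)"
    "f' ` (even_perms m - S') = f ` (copy (Suc m) i - S)"
proof -
  obtain g where g: "g \<in> copy (Suc m) i" using copy_nonempty[of "Suc m" i] assms by auto
  have inj: "inj (\<lambda>q. g \<circ> q)"
    using g by (auto simp: copy_def dest!: even_perms_inj intro!: injI simp: fun_eq_iff inj_eq)
  define S' where "S' = {q \<in> even_perms m. g \<circ> q \<in> S}"
  have im: "S \<inter> copy (Suc m) i = (\<lambda>q. g \<circ> q) ` S'"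
    by (auto simp: copy_eq_image[OF g] S'_def)
  have "locally_constant m S' (\<lambda>q. f (g \<circ> q))"
    unfolding locally_constant_def
  proof (intro ballI impI)
    fix p j assume p: "p \<in> even_perms m - S'" and j: "j \<in> gens m" "p \<circ> gen j \<notin> S'"
    have "p \<circ> gen j \<in> even_perms m" using p j assms by (simp add: comp_gen_in_even_perms)
    then have "g \<circ> p \<in> even_perms (Suc m) - S" "(g \<circ> p) \<circ> gen j \<notin> S" "j \<in> gens (Suc m)"
      using p j g copy_eq_image[OF g] by (auto simp: S'_def gens_def copy_def comp_assoc)
    then have "f ((g \<circ> p) \<circ> gen j) = f (g \<circ> p)"
      using f unfolding locally_constant_def by blast
    then show "f (g \<circ> (p \<circ> gen j)) = f (g \<circ> p)" by (simp add: comp_assoc)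
  qed
  moreover have "card S' = card (S \<inter> copy (Suc m) i)"
    unfolding im by (rule card_image[symmetric]) (metis inj inj_on_subset subset_UNIV)
  moreover have "(\<lambda>q. f (g \<circ> q)) ` (even_perms m - S') = f ` (copy (Suc m) i - S)"
    by (auto simp: copy_eq_image[OF g] S'_def image_iff)
  ultimately show thesis using that[of S' "\<lambda>q. f (g \<circ> q)"] by (auto simp: S'_def)
qed

text \<open>An edge between two copies of different colours must have a deleted end. Ordered pairs
  of copies count every such edge from both of its ends, and each deleted vertex accounts for at
  most itself and its partner under \<open>cross\<close>; hence the factor 2.\<close>

lemma differing_copies_le:
  assumes n: "n \<ge> 4" and S: "S \<subseteq> even_perms n" and f: "locally_constant n S f"
    and G: "G \<subseteq> {1..n}" and a: "\<And>i p. i \<in> G \<Longrightarrow> p \<in> copy n i - S \<Longrightarrow> f p = a i"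
  shows "card {(i, j) \<in> G \<times> G. a i \<noteq> a j} * block_bound n \<le> 2 * card {p \<in> S. p n \<in> G}"
proof -
  define P where "P = {(i, j) \<in> G \<times> G. a i \<noteq> a j}"
  define T where "T = {p \<in> S. p n \<in> G}"
  have finT: "finite T" using S by (auto simp: T_def intro: finite_subset[OF _ finite_even_perms])
  have "{p \<in> even_perms n. (p n, p 3) \<in> P} \<subseteq> T \<union> cross n ` T"
  proof
    fix p assume p: "p \<in> {p \<in> even_perms n. (p n, p 3) \<in> P}"
    consider "p \<in> S" | "cross n p \<in> S" | "p \<notin> S" "cross n p \<notin> S" by blast
    then show "p \<in> T \<union> cross n ` T"
    proof cases
      case 1
      then show ?thesis using p by (simp add: T_def P_def)
    next
      case 2
      then have "cross n p \<in> T" using p n by (simp add: T_def P_def cross_n)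
      then show ?thesis by (metis UnI2 cross_cross imageI n)
    next
      case 3
      have "f p = a (p n)" using p 3 a[of "p n" p] by (simp add: copy_def P_def)
      moreover have "f (cross n p) = a (p 3)"
        using p 3 n a[of "p 3" "cross n p"] by (simp add: copy_def P_def cross_n cross_in_even_perms)
      ultimately show ?thesis
        using locally_constant_cross[OF f n] p 3 by (auto simp: P_def)
    qed
  qed
  then have "card {p \<in> even_perms n. (p n, p 3) \<in> P} \<le> card (T \<union> cross n ` T)"
    by (rule card_mono[rotated]) (simp add: finT)
  also have "\<dots> \<le> card T + card T"
    by (metis add_left_mono card_Un_le card_image_le finT le_trans)
  finally have "card {p \<in> even_perms n. (p n, p 3) \<in> P} \<le> 2 * card T" by simp
  moreover have "card P * block_bound n \<le> card {p \<in> even_perms n. (p n, p 3) \<in> P}"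
    using G by (intro card_UN_block n) (auto simp: P_def)
  ultimately show ?thesis by (simp add: P_def T_def)
qed

text \<open>The induction invariant. The three bounds are kept together because the inductive step
  uses all of them for the copies; the last threshold is one below the claimed connectivity.\<close>

definition colour_bound :: "nat \<Rightarrow> (nat \<Rightarrow> nat) set \<Rightarrow> ((nat \<Rightarrow> nat) \<Rightarrow> 'c) \<Rightarrow> bool" where
  "colour_bound n S f \<longleftrightarrow>
     (card S \<le> n - 2 \<longrightarrow> card (f ` (even_perms n - S)) \<le> 1) \<and>
     (card S \<le> 2 * n - 4 \<longrightarrow> card (f ` (even_perms n - S)) \<le> 2) \<and>
     (card S \<le> 3 * n - 7 \<longrightarrow> card (f ` (even_perms n - S)) \<le> 3)"

subsection \<open>The case of dimension four\<close>

lemma even_perms_3_fix: "p \<in> even_perms 3 \<Longrightarrow> p 3 = 3 \<Longrightarrow> p = id"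
proof -
  assume p: "p \<in> even_perms 3" "p 3 = 3"
  have "{1..3::nat} = {1, 2, 3}" by auto
  then have "p permutes {1, 2}"
    using permutes_superset[of p "{1..3}" "{1, 2}"] p by (auto simp: even_perms_def)
  with p show ?thesis
    unfolding permutes_doubleton_iff by (auto simp: even_perms_def evenperm_swap)
qed

text \<open>The network of dimension 3 is a triangle: if the quotient \<open>s\<close> of two
  vertices does not fix 3, it agrees at 3 with some \<open>gen j\<close> and so equals it.\<close>

lemma locally_constant_3:
  assumes f: "locally_constant 3 S f" and p: "p \<in> even_perms 3 - S" and q: "q \<in> even_perms 3 - S"
  shows "f p = f q"
proof -
  have bij: "bij p" using p even_perms_permutes permutes_bij by blast
  define s where "s = inv p \<circ> q"
  have s: "s \<in> even_perms 3"
    unfolding s_def using p q by (intro even_perms_comp even_perms_inv) auto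
  have qs: "q = p \<circ> s"
    using bij by (simp add: s_def fun_eq_iff bij_is_surj surj_f_inv_f)
  show ?thesis
  proof (cases "s 3 = 3")
    case True
    then show ?thesis using even_perms_3_fix[OF s] qs by simp
  next
    case False
    define j where "j = s 3"
    have j: "j \<in> gens 3" using False even_perms_range[OF s, of 3] by (simp add: gens_def j_def)
    have gE: "gen j \<in> even_perms 3" using j by (simp add: gen_in_even_perms)
    have bg: "bij (gen j)" using gE even_perms_permutes permutes_bij by blast
    have "inv (gen j) \<circ> s \<in> even_perms 3" using s gE by (intro even_perms_comp even_perms_inv)
    moreover have "(inv (gen j) \<circ> s) 3 = 3"
      using bg by (metis comp_apply bij_inv_eq_iff gen_3 j_def)
    ultimately have "inv (gen j) \<circ> s = id" by (rule even_perms_3_fix)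
    then have "s = gen j"
      using bg by (metis bij_is_surj comp_assoc comp_id id_comp surj_iff)
    then show ?thesis using f p q qs j by (auto simp: locally_constant_def)
  qed
qed

text \<open>Among the six pairs of four objects, two classes give at least 3 unequal pairs, three
  classes give 5 and four classes give 6.\<close>

lemma four_colours:
  defines "N w x y z \<equiv> of_bool (w \<noteq> x) + of_bool (w \<noteq> y) + of_bool (w \<noteq> z)
    + of_bool (x \<noteq> y) + of_bool (x \<noteq> z) + (of_bool (y \<noteq> z) :: nat)"
  shows "N w x y z \<le> 2 \<Longrightarrow> card {w, x, y, z} \<le> 1"
    and "N w x y z \<le> 4 \<Longrightarrow> card {w, x, y, z} \<le> 2"
    and "N w x y z \<le> 5 \<Longrightarrow> card {w, x, y, z} \<le> 3"
  unfolding N_def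
  by (cases "w = x"; cases "w = y"; cases "w = z"; cases "x = y"; cases "x = z"; cases "y = z";
      simp add: card_insert_if)+

text \<open>The copies are triangles, hence monochromatic, and any two are joined by an edge. As
  these edges are disjoint, every pair of differently coloured copies costs its own deletion; the
  thresholds 2, 4, 5 are those of \<open>four_colours\<close>.\<close>

lemma colour_bound_4:
  assumes S: "S \<subseteq> even_perms 4" and f: "locally_constant 4 S f"
  shows "colour_bound 4 S f"
proof -
  have "\<forall>i\<in>{1..4}. \<exists>c. \<forall>p \<in> copy 4 i - S. f p = c"
  proof
    fix i :: nat assume i: "i \<in> {1..4}"
    obtain S' f' where *: "locally_constant 3 S' f'" "f' ` (even_perms 3 - S') = f ` (copy 4 i - S)"
    proof (rule locally_constant_restrict_copy)
      show "(3::nat) \<le> 3" "i \<in> {1..Suc 3}" "locally_constant (Suc 3) S f" using i f by simp_all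
    qed (use that in simp)
    have "f p = f q" if "p \<in> copy 4 i - S" "q \<in> copy 4 i - S" for p q
    proof -
      have "f p \<in> f' ` (even_perms 3 - S')" "f q \<in> f' ` (even_perms 3 - S')"
        unfolding *(2) using that by simp_all
      then show ?thesis using locally_constant_3[OF *(1)] by (elim imageE) metis
    qed
    then show "\<exists>c. \<forall>p \<in> copy 4 i - S. f p = c" by blast
  qed
  \<comment> \<open>A copy that is deleted entirely gets an arbitrary colour; this is harmless,
    since the colours in use still lie among the values of \<open>a\<close>.\<close>
  then obtain a where a: "\<And>i p. i \<in> {1..4} \<Longrightarrow> p \<in> copy 4 i - S \<Longrightarrow> f p = a i"
    by metis
  define N where "N = of_bool (a 1 \<noteq> a 2) + of_bool (a 1 \<noteq> a 3) + of_bool (a 1 \<noteq> a 4)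
    + of_bool (a 2 \<noteq> a 3) + of_bool (a 2 \<noteq> a 4) + (of_bool (a 3 \<noteq> a 4) :: nat)"
  have four: "{1..4} = {1, 2, 3, 4::nat}" by auto
  have "{(i, j) \<in> {1..4} \<times> {1..4}. a i \<noteq> a j} =
      {1..4} \<times> {1..4} \<inter> {x. a (fst x) \<noteq> a (snd x)}" by auto
  then have "card {(i, j) \<in> {1..4} \<times> {1..4}. a i \<noteq> a j} =
      (\<Sum>x\<in>{1..4} \<times> {1..4}. of_bool (a (fst x) \<noteq> a (snd x)))"
    by (simp only: sum_of_bool_eq finite_cartesian_product finite_atLeastAtMost of_nat_id)
  also have "\<dots> = (\<Sum>i\<in>{1..4}. \<Sum>j\<in>{1..4}. of_bool (a i \<noteq> a j))"
    by (simp only: sum.cartesian_product case_prod_unfold)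
  \<comment> \<open>The diagonal contributes nothing and each unordered pair occurs twice.\<close>
  also have "\<dots> = 2 * N"
    unfolding four N_def
    by (simp add: eq_commute[of "a 2" "a (Suc 0)"] eq_commute[of "a 3" "a (Suc 0)"]
        eq_commute[of "a 4" "a (Suc 0)"] eq_commute[of "a 3" "a 2"] eq_commute[of "a 4" "a 2"]
        eq_commute[of "a 4" "a 3"])
  finally have "2 * N \<le> 2 * card {p \<in> S. p 4 \<in> {1..4}}"
    using differing_copies_le[of 4 S f "{1..4}" a, OF _ S f _ a] by (simp add: block_bound_def)
  moreover have "card {p \<in> S. p 4 \<in> {1..4}} \<le> card S"
    using S by (intro card_mono) (auto intro: finite_subset)
  ultimately have N: "N \<le> card S" by linarith
  have "f ` (even_perms 4 - S) \<subseteq> a ` {1..4}"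
  proof
    fix c assume "c \<in> f ` (even_perms 4 - S)"
    then obtain p where p: "p \<in> even_perms 4 - S" "c = f p" by blast
    then have "p 4 \<in> {1..4}" using even_perms_range[of p 4 4] by simp
    with a[of "p 4" p] p show "c \<in> a ` {1..4}" by (auto simp: copy_def)
  qed
  then have "card (f ` (even_perms 4 - S)) \<le> card {a 1, a 2, a 3, a 4}"
    unfolding four by (intro card_mono) auto
  with N four_colours[of "a 1" "a 2" "a 3" "a 4", folded N_def] show ?thesis
    unfolding colour_bound_def by auto
qed

subsection \<open>The inductive step\<close>

text \<open>The premise \<open>copies\<close> is the invariant for dimension \<open>n - 1\<close>,
  read inside each copy.\<close>

lemma colour_bound_step:
  fixes f :: "(nat \<Rightarrow> nat) \<Rightarrow> 'c"
  assumes n: "n \<ge> 5" and S: "S \<subseteq> even_perms n" and f: "locally_constant n S f"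
    and copies: "\<And>i. i \<in> {1..n} \<Longrightarrow>
        (card (S \<inter> copy n i) \<le> n - 3 \<longrightarrow> card (f ` (copy n i - S)) \<le> 1) \<and>
        (card (S \<inter> copy n i) \<le> 2 * n - 6 \<longrightarrow> card (f ` (copy n i - S)) \<le> 2) \<and>
        (card (S \<inter> copy n i) \<le> 3 * n - 10 \<longrightarrow> card (f ` (copy n i - S)) \<le> 3)"
    and card_S: "card S \<le> 3 * n - 7"
  shows "(card S \<le> n - 2 \<longrightarrow> card (f ` (even_perms n - S)) \<le> 1) \<and>
    (card S \<le> 2 * n - 4 \<longrightarrow> card (f ` (even_perms n - S)) \<le> 2) \<and>
    card (f ` (even_perms n - S)) \<le> 3"
proof -
  have n4: "n \<ge> 4" using n by simp
  have finS [simp]: "finite S" by (rule finite_subset[OF S]) simp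
  define s where "s i = card (S \<inter> copy n i)" for i
  define B where "B = {i \<in> {1..n}. n - 2 \<le> s i}"
  define G where "G = {1..n} - B"
  have fin [simp]: "finite B" "finite G" by (simp_all add: B_def G_def)
  have BG: "B \<subseteq> {1..n}" "G \<subseteq> {1..n}" "card G + card B = n"
  proof -
    show B: "B \<subseteq> {1..n}" and "G \<subseteq> {1..n}" by (auto simp: B_def G_def)
    show "card G + card B = n"
      using card_Diff_subset[OF fin(1) B] card_mono[OF _ B] by (simp add: G_def)
  qed
  have sum_bad: "card {p \<in> S. p n \<in> G} + sum s B = card S"
  proof -
    have "sum s B = card (\<Union>i\<in>B. S \<inter> copy n i)"
      unfolding s_def by (rule card_UN_disjoint[symmetric]) (auto simp: copy_def)
    also have "card {p \<in> S. p n \<in> G} + \<dots> = card ({p \<in> S. p n \<in> G} \<union> (\<Union>i\<in>B. S \<inter> copy n i))"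
      by (rule card_Un_disjoint[symmetric]) (auto simp: copy_def G_def)
    also have "{p \<in> S. p n \<in> G} \<union> (\<Union>i\<in>B. S \<inter> copy n i) = S"
      using S even_perms_range[of _ n n] n by (auto simp: copy_def G_def)
    finally show ?thesis .
  qed
  have bad_le: "card B * (n - 2) \<le> sum s B"
    using sum_bounded_below[of B "n - 2" s] by (simp add: B_def)
  \<comment> \<open>Three bad copies would take 3n - 6 deletions, one more than allowed.\<close>
  have "card B < 3"
  proof (rule ccontr)
    assume "\<not> card B < 3"
    then have "3 * (n - 2) \<le> card B * (n - 2)" by (intro mult_right_mono) auto
    then show False using bad_le sum_bad card_S n by linarith
  qed
  then have B_cases: "card B = 0 \<or> card B = 1 \<or> card B = 2" by linarith
  have "\<forall>i\<in>G. \<exists>c. \<forall>p \<in> copy n i - S. f p = c"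
  proof
    fix i assume "i \<in> G"
    then have "card (f ` (copy n i - S)) \<le> 1" using copies[of i] by (auto simp: G_def B_def s_def)
    then have "f ` (copy n i - S) = {} \<or> (\<exists>c. f ` (copy n i - S) = {c})"
      by (metis One_nat_def card_0_eq card_1_singletonE finite_Diff finite_copy finite_imageI le_Suc_eq le_zero_eq)
    then show "\<exists>c. \<forall>p \<in> copy n i - S. f p = c" by blast
  qed
  then obtain a where a: "\<And>i p. i \<in> G \<Longrightarrow> p \<in> copy n i - S \<Longrightarrow> f p = a i"
    by metis
  have a_eq: "a i = a j" if ij: "i \<in> G" "j \<in> G" for i j
  proof (rule ccontr)
    assume neq: "a i \<noteq> a j"
    \<comment> \<open>Splitting the good copies into two nonempty classes leaves at least
      \<open>card G - 1\<close> pairs across, each with three edges to destroy. This exceeds the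
      deletions that the bad copies leave over.\<close>
    define I where "I = {k \<in> G. a k = a i}"
    define J where "J = G - I"
    have IJ: "finite I" "finite J" "I \<noteq> {}" "J \<noteq> {}" "I \<inter> J = {}" "I \<union> J = G"
      using ij neq by (auto simp: I_def J_def)
    have G: "card G = card I + card J" using IJ by (metis card_Un_disjoint)
    have pos: "card I \<ge> 1" "card J \<ge> 1" using IJ by (auto simp: Suc_le_eq card_gt_0_iff)
    have "card (I \<times> J \<union> J \<times> I) = 2 * (card I * card J)"
      using IJ by (subst card_Un_disjoint) (auto simp: card_cartesian_product)
    moreover have "card (I \<times> J \<union> J \<times> I) \<le> card {(k, l) \<in> G \<times> G. a k \<noteq> a l}"
    proof (rule card_mono)
      show "finite {(k, l) \<in> G \<times> G. a k \<noteq> a l}"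
        by (rule finite_subset[of _ "G \<times> G"]) auto
    qed (auto simp: I_def J_def)
    moreover have "card {(k, l) \<in> G \<times> G. a k \<noteq> a l} * 3 \<le> 2 * card {p \<in> S. p n \<in> G}"
      using differing_copies_le[OF n4 S f BG(2) a] n by (simp add: block_bound_def)
    ultimately have "3 * (card I * card J) \<le> card {p \<in> S. p n \<in> G}" by linarith
    moreover have "card I + card J \<le> card I * card J + 1"
      using pos by (cases "card I"; cases "card J") auto
    ultimately show False
      using B_cases sum_bad bad_le card_S BG(3) G n by (elim disjE) auto
  qed
  have "G \<noteq> {}" using BG(3) B_cases n by auto
  then obtain i0 where "i0 \<in> G" by blast
  define c where "c = a i0"
  have good: "f p = c" if "p \<in> even_perms n" "p \<notin> S" "p n \<in> G" for p
    using a[of "p n" p] a_eq[OF that(3) \<open>i0 \<in> G\<close>] that by (simp add: c_def copy_def)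
  have good_cross: "cross n p \<in> S" if "p \<in> even_perms n" "p \<notin> S" "p 3 \<in> G" "f p \<noteq> c" for p
    using good[of "cross n p"] locally_constant_cross[OF f n4, of p] that n4
    by (auto simp: cross_in_even_perms cross_n)
  \<comment> \<open>Otherwise every edge from copy \<open>b\<close> to a good copy has a deleted
    end. There are at least n - 2 good copies, so at least 3(n - 2) such edges, more than
    \<open>card S\<close>.\<close>
  have joined: "c \<in> f ` (copy n b - S)" if b: "b \<in> B" for b
  proof (rule ccontr)
    assume neg: "c \<notin> f ` (copy n b - S)"
    let ?M = "{p \<in> even_perms n. (p n, p 3) \<in> {b} \<times> G}"
    have "?M \<subseteq> (S \<inter> copy n b) \<union> cross n ` (S - copy n b)"
    proof
      fix p assume p: "p \<in> ?M"
      show "p \<in> (S \<inter> copy n b) \<union> cross n ` (S - copy n b)"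
      proof (cases "p \<in> S")
        case True
        then show ?thesis using p by (simp add: copy_def)
      next
        case False
        then have "f p \<noteq> c" using neg p by (auto simp: copy_def)
        then have "cross n p \<in> S" using good_cross p False by auto
        moreover have "cross n p \<notin> copy n b" using p b n4 by (auto simp: copy_def cross_n G_def)
        ultimately show ?thesis by (metis DiffI UnI2 cross_cross imageI n4)
      qed
    qed
    then have "card ?M \<le> card ((S \<inter> copy n b) \<union> cross n ` (S - copy n b))"
      by (rule card_mono[rotated]) simp
    also have "\<dots> \<le> card (S \<inter> copy n b) + card (S - copy n b)"
      by (metis (no_types, lifting) add_left_mono card_Un_le card_image_le finS finite_Diff le_trans)
    also have "\<dots> = card S" by (simp add: card_Int_Diff flip: card_Int_Diff)
    finally have "card ?M \<le> card S" .
    moreover have "card ({b} \<times> G) * block_bound n \<le> card ?M"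
      by (rule card_UN_block[OF n4]) (use b BG in \<open>auto simp: G_def\<close>)
    ultimately show False
      using B_cases BG(3) n card_S by (auto simp: block_bound_def card_cartesian_product)
  qed
  \<comment> \<open>Since \<open>c\<close> does occur in a bad copy, discarding it lowers the bounds
    2 and 3 of the induction hypothesis to 1 and 2.\<close>
  define X where "X b = f ` (copy n b - S) - {c}" for b
  have finX [simp]: "finite (X b)" for b by (simp add: X_def)
  have card_X: "card (X b) = card (f ` (copy n b - S)) - 1" if "b \<in> B" for b
    using joined[OF that] by (simp add: X_def)
  have bn: "b \<in> {1..n}" if "b \<in> B" for b using that BG(1) by blast
  have X1: "card (X b) \<le> 1" if "b \<in> B" "s b \<le> 2 * n - 6" for b
    using copies[OF bn[OF that(1)]] that(2) card_X[OF that(1)] unfolding s_def by linarith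
  have X2: "card (X b) \<le> 2" if "b \<in> B" "s b \<le> 3 * n - 10" for b
    using copies[OF bn[OF that(1)]] that(2) card_X[OF that(1)] unfolding s_def by linarith
  have "f ` (even_perms n - S) \<subseteq> insert c (\<Union>b\<in>B. X b)"
  proof
    fix d assume "d \<in> f ` (even_perms n - S)"
    then obtain p where p: "p \<in> even_perms n" "p \<notin> S" "d = f p" by blast
    moreover have "p n \<in> {1..n}" using even_perms_range[OF p(1)] n by simp
    ultimately show "d \<in> insert c (\<Union>b\<in>B. X b)"
      using good[of p] by (cases "p n \<in> G") (auto simp: G_def X_def copy_def)
  qed
  then have "card (f ` (even_perms n - S)) \<le> card (insert c (\<Union>b\<in>B. X b))"
    by (rule card_mono[rotated]) simp
  then have total: "card (f ` (even_perms n - S)) \<le> Suc (card (\<Union>b\<in>B. X b))"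
    using card_insert_le[of "\<Union>b\<in>B. X b" c] by (auto simp: card_insert_if split: if_splits)
  have two_bad: ?thesis if B: "B = {b1, b2}" "b1 \<noteq> b2" "s b2 \<le> s b1" for b1 b2
  proof -
    have sums: "card {p \<in> S. p n \<in> G} + s b1 + s b2 = card S" using sum_bad B by simp
    have lower: "n - 2 \<le> s b1" "n - 2 \<le> s b2" using B by (auto simp: B_def)
    have b12: "b1 \<in> B" "b2 \<in> B" using B by auto
    \<comment> \<open>The smaller of the two cuts has at most (3n - 7)/2 vertices, which is at most
      2n - 6 once n \<ge> 5.\<close>
    have Xb2: "card (X b2) \<le> 1" using X1[OF b12(2)] sums lower card_S B(3) n by linarith
    have le_sum: "card (\<Union>b\<in>B. X b) \<le> card (X b1) + card (X b2)"
      using card_Un_le[of "X b1" "X b2"] B by simp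
    \<comment> \<open>All neighbours of a vertex \<^term>\<open>w\<close> of colour other than \<^term>\<open>c\<close> in copy \<^term>\<open>b2\<close> within that copy
      are deleted, and they exhaust the cut there. None of them leads to copy \<^term>\<open>b1\<close>, so every
      vertex of copy \<^term>\<open>b1\<close> of colour other than \<^term>\<open>c\<close> is joined to copy \<^term>\<open>b2\<close>.\<close>
    have absorb: "X b1 \<subseteq> X b2"
      if tight: "s b2 = n - 2" "card {p \<in> S. p n \<in> G} = 0" and "X b2 \<noteq> {}"
    proof -
      have rest: "p n \<notin> G" if "p \<in> S" for p using tight that by auto
      have out: "p 3 \<in> B" if "p \<in> even_perms n" "p \<notin> S" "f p \<noteq> c" for p
      proof -
        have "p 3 \<in> {1..n}" using even_perms_range[OF that(1), of 3] n by simp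
        moreover have "p 3 \<notin> G"
          using good_cross[OF that(1,2) _ that(3)] rest[of "cross n p"] n4 by (auto simp: cross_n)
        ultimately show ?thesis by (simp add: G_def)
      qed
      obtain w where w: "w \<in> copy n b2 - S" "f w \<noteq> c"
        using \<open>X b2 \<noteq> {}\<close> by (auto simp: X_def)
      have wE: "w \<in> even_perms n" "w \<notin> S" "w n = b2" using w by (auto simp: copy_def)
      have w3: "w 3 = b1"
        using out[OF wE(1,2) w(2)] even_perms_neq[OF wE(1), of 3 n] n wE(3) B by auto
      have nbr: "w \<circ> gen j \<in> S \<inter> copy n b2" if j: "j \<in> gens (n - 1)" for j
      proof -
        have jn: "j \<in> gens n" "j \<noteq> n" using j n by (auto simp: gens_def)
        have E: "w \<circ> gen j \<in> even_perms n" using comp_gen_in_even_perms wE jn n by simp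
        have "gen j n = n"
          using jn n by (simp add: gen_def Transposition.transpose_def)
        then have C: "(w \<circ> gen j) n = b2" by (simp add: wE)
        have "w j \<noteq> w 3" "w j \<noteq> w n" using even_perms_neq[OF wE(1)] jn by (auto simp: gens_def)
        then have "(w \<circ> gen j) 3 \<notin> B" using B w3 wE by simp
        moreover have "f (w \<circ> gen j) = f w" if "w \<circ> gen j \<notin> S"
          using f wE jn that by (auto simp: locally_constant_def)
        ultimately have "w \<circ> gen j \<in> S" using out[OF E] w(2) by auto
        with E C show ?thesis by (simp add: copy_def)
      qed
      have "inj_on (\<lambda>j. w \<circ> gen j) (gens (n - 1))"
        by (rule inj_onI) (metis comp_apply even_perms_inj gen_3 injD wE(1))
      then have "card ((\<lambda>j. w \<circ> gen j) ` gens (n - 1)) = n - 2"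
        using n by (simp add: card_image gens_def)
      with tight nbr have nbrs: "(\<lambda>j. w \<circ> gen j) ` gens (n - 1) = S \<inter> copy n b2"
        by (intro card_subset_eq) (auto simp: s_def)
      have f_v: "f v = f w" if v: "v \<in> copy n b1 - S" "f v \<noteq> c" for v
      proof -
        have vE: "v \<in> even_perms n" "v \<notin> S" "v n = b1" using v by (auto simp: copy_def)
        have v3: "v 3 = b2"
          using out[OF vE(1,2) v(2)] even_perms_neq[OF vE(1), of 3 n] n vE(3) B by auto
        have u: "cross n v \<in> copy n b2" "cross n v 3 = b1"
          using vE v3 n4 by (auto simp: copy_def cross_n cross_3 cross_in_even_perms)
        have "cross n v \<notin> S"
        proof
          assume "cross n v \<in> S"
          with nbrs u obtain j where "j \<in> gens (n - 1)" "cross n v = w \<circ> gen j" by blast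
          then show False using u(2) w3 even_perms_neq[OF wE(1), of j 3] by (simp add: gens_def)
        qed
        then have eq: "f (cross n v) = f v" "cross n v \<in> copy n b2 - S"
          using locally_constant_cross[OF f n4 vE(1,2)] u by auto
        have "f (cross n v) \<in> X b2" using imageI[OF eq(2), of f] eq(1) v(2)
          by (simp add: X_def)
        moreover have "f w \<in> X b2" using w by (simp add: X_def)
        ultimately show ?thesis using Xb2 eq(1) by (metis card_le_Suc0_iff_eq finX One_nat_def)
      qed
      then show ?thesis using w by (auto simp: X_def)
    qed
    \<comment> \<open>In the tight case the extra colours of one bad copy absorb those of the other,
      or \<open>X b2\<close> is empty. Otherwise at least one further deletion is spent outside copy
      \<open>b1\<close>, or in both bad copies, so \<open>s b1\<close> is at most 2n - 6 and each
      bad copy adds at most one colour.\<close>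
    show ?thesis
    proof (cases "s b2 = n - 2 \<and> card {p \<in> S. p n \<in> G} = 0")
      case True
      have "card (\<Union>b\<in>B. X b) \<le> max (card (X b1)) 1"
      proof (cases "X b2 = {}")
        case True
        then show ?thesis using B by simp
      next
        case False
        then have "(\<Union>b\<in>B. X b) = X b2" using absorb True B by auto
        then show ?thesis using Xb2 by simp
      qed
      moreover have "card (X b1) \<le> 2" using X2[OF b12(1)] sums True card_S n by linarith
      moreover have "card (X b1) \<le> 1" if "card S \<le> 2 * n - 4"
        using X1[OF b12(1)] sums True that n by linarith
      moreover have "\<not> card S \<le> n - 2" using sums lower n by linarith
      ultimately show ?thesis using total by (auto simp: max_def split: if_splits)
    next
      case False
      then have "s b2 > n - 2 \<or> card {p \<in> S. p n \<in> G} > 0" using lower by linarith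
      then have "s b1 \<le> 2 * n - 6" "\<not> card S \<le> 2 * n - 4"
        using sums lower card_S B(3) n by linarith+
      with X1[OF b12(1)] Xb2 le_sum total n show ?thesis by auto
    qed
  qed
  from B_cases consider "B = {}" | b where "B = {b}" | b1 b2 where "B = {b1, b2}" "b1 \<noteq> b2"
    by (metis card_0_eq card_1_singletonE card_2_iff fin(1))
  then show ?thesis
  proof cases
    case 1
    then show ?thesis using total by simp
  next
    case (2 b)
    let ?R = "{p \<in> S. p n \<in> G}"
    \<comment> \<open>With one bad copy, a vertex there of colour other than \<open>c\<close> has
      its outside neighbour deleted in a good copy. So extra colours are bounded by the deletions in
      good copies, of which few remain when \<open>s b\<close> is beyond the reach of the induction
      hypothesis.\<close>
    have "X b \<subseteq> (\<lambda>p. f (cross n p)) ` ?R"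
    proof
      fix d assume "d \<in> X b"
      then obtain p where p: "p \<in> even_perms n" "p \<notin> S" "p n = b" "d = f p" "f p \<noteq> c"
        by (auto simp: X_def copy_def)
      have "p 3 \<in> {1..n}" "p 3 \<noteq> p n"
        using even_perms_range[OF p(1), of 3] even_perms_neq[OF p(1), of 3 n] n by auto
      then have p3: "p 3 \<in> G" using p(3) 2 by (simp add: G_def)
      then have "cross n p \<in> ?R" using good_cross[OF p(1,2) _ p(5)] n4 by (simp add: cross_n)
      then show "d \<in> (\<lambda>p. f (cross n p)) ` ?R" using p(4) by (metis (no_types, lifting) cross_cross imageI n4)
    qed
    then have "card (X b) \<le> card ((\<lambda>p. f (cross n p)) ` ?R)" by (rule card_mono[rotated]) simp
    also have "\<dots> \<le> card ?R" by (rule card_image_le) simp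
    finally have XR: "card (X b) \<le> card ?R" .
    have sums: "card ?R + s b = card S" "n - 2 \<le> s b" "b \<in> B"
      using sum_bad 2 by (auto simp: B_def)
    have "card (X b) = 0" if "card S \<le> n - 2" using that XR sums by linarith
    moreover have "card (X b) \<le> 1" if "card S \<le> 2 * n - 4"
      using that XR sums X1[of b] n by (cases "s b \<le> 2 * n - 6") auto
    moreover have "card (X b) \<le> 2" 
      using card_S XR sums X2[of b] n by (cases "s b \<le> 3 * n - 10") auto
    ultimately show ?thesis using total 2 by auto
  next
    case (3 b1 b2)
    then show ?thesis
    proof (cases "s b2 \<le> s b1")
      case True
      with 3 show ?thesis by (rule two_bad)
    next
      case False
      have "B = {b2, b1}" using 3(1) by (simp add: insert_commute)
      then show ?thesis by (rule two_bad) (use 3(2) False in simp_all)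
    qed
  qed
qed

lemma colour_bound:
  assumes "n \<ge> 4" "S \<subseteq> even_perms n" "locally_constant n S f"
  shows "colour_bound n S f"
  using assms
proof (induction n arbitrary: S f rule: dec_induct)
  case base
  then show ?case by (rule colour_bound_4)
next
  case (step m)
  have *: "(card (S \<inter> copy (Suc m) i) \<le> Suc m - 3 \<longrightarrow> card (f ` (copy (Suc m) i - S)) \<le> 1) \<and>
        (card (S \<inter> copy (Suc m) i) \<le> 2 * Suc m - 6 \<longrightarrow> card (f ` (copy (Suc m) i - S)) \<le> 2) \<and>
        (card (S \<inter> copy (Suc m) i) \<le> 3 * Suc m - 10 \<longrightarrow> card (f ` (copy (Suc m) i - S)) \<le> 3)"
    if i: "i \<in> {1..Suc m}" for i
  proof -
    have "m \<ge> 3" using step.hyps by simp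
    then obtain S' f' where *: "S' \<subseteq> even_perms m" "locally_constant m S' f'"
      "card S' = card (S \<inter> copy (Suc m) i)" "f' ` (even_perms m - S') = f ` (copy (Suc m) i - S)"
      using locally_constant_restrict_copy[OF _ i step.prems(2)] by blast
    have "Suc m - 3 = m - 2" "2 * Suc m - 6 = 2 * m - 4" "3 * Suc m - 10 = 3 * m - 7" by simp_all
    then show ?thesis
      using step.IH[OF *(1,2)] unfolding colour_bound_def *(3,4) by simp
  qed
  have "m \<ge> 4" by (rule step.hyps)
  then have le: "Suc m - 2 \<le> 3 * Suc m - 7" "2 * Suc m - 4 \<le> 3 * Suc m - 7" "Suc m \<ge> 5"
    by simp_all
  show ?case
  proof (cases "card S \<le> 3 * Suc m - 7")
    case True
    from colour_bound_step[OF le(3) step.prems * True] show ?thesis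
      unfolding colour_bound_def by blast
  next
    \<comment> \<open>Beyond the largest threshold all three implications are vacuous.\<close>
    case False
    then have "\<not> card S \<le> Suc m - 2" "\<not> card S \<le> 2 * Suc m - 4" using le by linarith+
    with False show ?thesis unfolding colour_bound_def by blast
  qed
qed

subsection \<open>Components as colours\<close>

text \<open>Colouring a vertex by its component is locally constant, so the colour bounds limit the
  number of components. Conversely every locally constant colouring factors through components,
  which turns a colouring with many colours into many components.\<close>

lemma
  fixes n :: nat and S :: "(nat \<Rightarrow> nat) set"
  assumes n: "n \<ge> 3"
  defines "H \<equiv> with_proj (AN n) \<restriction> (even_perms n - S)"
  shows scc_of_locally_constant: "locally_constant n S (pre_digraph.scc_of H)"
    and card_sccs_AN: "card (pre_digraph.sccs H) = card (pre_digraph.scc_of H ` (even_perms n - S))"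
    and card_colours_le_sccs:
      "\<And>f :: (nat \<Rightarrow> nat) \<Rightarrow> 'c. locally_constant n S f \<Longrightarrow>
        card (f ` (even_perms n - S)) \<le> card (pre_digraph.sccs H)"
    and connected_imp_constant:
      "\<And>(f :: (nat \<Rightarrow> nat) \<Rightarrow> 'c) u v. locally_constant n S f \<Longrightarrow> Digraph_Component.connected H \<Longrightarrow>
        u \<in> even_perms n - S \<Longrightarrow> v \<in> even_perms n - S \<Longrightarrow> f u = f v"
proof -
  interpret G: pair_graph "AN n" by (rule pair_graph_AN[OF n])
  interpret H: wf_digraph H unfolding H_def by (rule G.wellformed_induce_subgraph)
  have verts_H: "verts H = even_perms n - S" by (simp add: H_def)
  have finV: "finite (even_perms n - S)" by simp
  have adj_iff: "u \<rightarrow>\<^bsub>H\<^esub> v \<longleftrightarrow> u \<in> even_perms n - S \<and> v \<in> even_perms n - S \<and> (\<exists>j\<in>gens n. v = u \<circ> gen j)"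
    for u v
  proof -
    have "u \<rightarrow>\<^bsub>H\<^esub> v \<longleftrightarrow> (u, v) \<in> arcs H"
      by (auto simp: H_def arcs_ends_conv image_iff)
    also have "\<dots> \<longleftrightarrow> u \<in> even_perms n - S \<and> v \<in> even_perms n - S \<and> AN_adj n u v"
      by (auto simp: H_def AN_def)
    finally show ?thesis using AN_adj_iff_gen[OF n, of u v] by blast
  qed
  have sym: "symmetric H"
    unfolding H_def
    by (rule induced_graph_imp_symmetric[OF G.sym_arcs], rule G.induced_induce) (auto simp: AN_def)
  show "locally_constant n S (pre_digraph.scc_of H)"
    unfolding locally_constant_def
  proof (intro ballI impI)
    fix p j assume p: "p \<in> even_perms n - S" and j: "j \<in> gens n" "p \<circ> gen j \<notin> S"
    then have "p \<circ> gen j \<in> even_perms n - S" using comp_gen_in_even_perms n by blast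
    with p j have "p \<rightarrow>\<^bsub>H\<^esub> (p \<circ> gen j)" by (auto simp: adj_iff)
    then have 1: "p \<rightarrow>\<^sup>*\<^bsub>H\<^esub> (p \<circ> gen j)" by (rule H.reachable_adjI)
    then have 2: "(p \<circ> gen j) \<rightarrow>\<^sup>*\<^bsub>H\<^esub> p" by (rule symmetric_reachable[OF sym])
    show "H.scc_of (p \<circ> gen j) = H.scc_of p"
      unfolding H.scc_of_def using 1 2 H.reachable_trans by blast
  qed
  have sccs: "card H.sccs = card (H.scc_of ` (even_perms n - S))"
    by (metis H.card_sccs_verts H.sccs_verts_conv_scc_of verts_H)
  then show "card H.sccs = card (H.scc_of ` (even_perms n - S))" .
  have const: "f u = f v" if f: "locally_constant n S f" and "u \<rightarrow>\<^sup>*\<^bsub>H\<^esub> v"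
    for f :: "(nat \<Rightarrow> nat) \<Rightarrow> 'c" and u v
    using that(2)
  proof (induction rule: H.reachable_induct)
    case (step x y)
    then have "f y = f x" using f by (auto simp: adj_iff locally_constant_def)
    with step show ?case by simp
  qed simp
  {
    fix f :: "(nat \<Rightarrow> nat) \<Rightarrow> 'c" assume f: "locally_constant n S f"
    \<comment> \<open>A chosen representative of each component exhibits \<open>f\<close> as a
      function of the component.\<close>
    have "f u = f (SOME v. v \<in> H.scc_of u)" if "u \<in> even_perms n - S" for u
    proof -
      have "u \<in> H.scc_of u" using that by (simp add: H.in_scc_of_self verts_H)
      then have "(SOME v. v \<in> H.scc_of u) \<in> H.scc_of u"
        by (rule someI[of "\<lambda>v. v \<in> H.scc_of u"])
      then show ?thesis by (intro const[OF f]) (simp add: H.scc_of_def)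
    qed
    then have "f ` (even_perms n - S) =
        (\<lambda>C. f (SOME v. v \<in> C)) ` H.scc_of ` (even_perms n - S)"
      unfolding image_image by (rule image_cong[OF refl])
    then show "card (f ` (even_perms n - S)) \<le> card H.sccs"
      unfolding sccs by (metis card_image_le finV finite_imageI)
  }
  {
    fix f :: "(nat \<Rightarrow> nat) \<Rightarrow> 'c" and u v
    assume f: "locally_constant n S f" and H: "Digraph_Component.connected H"
      and uv: "u \<in> even_perms n - S" "v \<in> even_perms n - S"
    have "u \<rightarrow>\<^sup>*\<^bsub>mk_symmetric H\<^esub> v"
      using H uv by (auto simp: connected_def strongly_connected_def verts_H)
    then show "f u = f v" using const[OF f] H.reachable_mk_symmetric_eq[OF sym] by blast
  }
qed

subsection \<open>An optimal cut\<close>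

text \<open>The permutations \<^term>\<open>hex\<close>, its square and the identity are alternate vertices of a hexagon,
  so that any two of them share a neighbour. All three fix 1, while no generator does.\<close>

definition hex :: "nat \<Rightarrow> nat" where
  "hex = gen 2 \<circ> gen 4"

definition hex_cut :: "nat \<Rightarrow> (nat \<Rightarrow> nat) set" where
  "hex_cut n = (\<Union>c\<in>{id, hex, hex \<circ> hex}. (\<lambda>j. c \<circ> gen j) ` gens n)"

lemma hex_apply: "hex x = (if x = 2 then 3 else if x = 3 then 4 else if x = 4 then 2 else x)"
proof -
  consider "x = 1" | "x = 2" | "x = 3" | "x = 4" | "x \<notin> {1, 2, 3, 4}" by blast
  then show ?thesis by cases (simp_all add: hex_def gen_def Transposition.transpose_def)
qed

lemma hex_cube: "hex \<circ> hex \<circ> hex = id"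
  by (rule ext) (simp add: hex_apply)

lemma gen_4_gen_4: "gen 4 \<circ> gen 4 = id"
  using cross_cross[of 4 id] by (simp add: cross_def)

lemma hex_in_even_perms: "n \<ge> 4 \<Longrightarrow> hex \<in> even_perms n"
  unfolding hex_def by (intro even_perms_comp gen_in_even_perms) (auto simp: gens_def)

text \<open>Each of the three vertices has n - 1 neighbours, but its neighbour along
  \<open>gen 4\<close> is the neighbour of another one along \<open>gen 2\<close>. Dropping the
  index 4 loses nothing and leaves three sets of at most n - 2 vertices.\<close>

lemma card_hex_cut:
  assumes "n \<ge> 4"
  shows "card (hex_cut n) \<le> 3 * n - 6"
proof -
  let ?N = "\<lambda>c. (\<lambda>j. c \<circ> gen j) ` (gens n - {4})"
  have share: "c \<circ> gen 4 = (c \<circ> hex \<circ> hex) \<circ> gen 2" for c :: "nat \<Rightarrow> nat"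
  proof -
    have "(c \<circ> hex \<circ> hex) \<circ> gen 2 = c \<circ> (hex \<circ> hex \<circ> (gen 2 \<circ> (gen 4 \<circ> gen 4)))"
      by (simp add: gen_4_gen_4 comp_assoc)
    also have "\<dots> = c \<circ> ((hex \<circ> hex \<circ> hex) \<circ> gen 4)" by (simp add: hex_def comp_assoc)
    finally show ?thesis by (simp add: hex_cube)
  qed
  have h4: "hex \<circ> hex \<circ> hex \<circ> c = c" for c by (simp add: hex_cube)
  have "2 \<in> gens n - {4}" using assms by (simp add: gens_def)
  then have two: "c \<circ> gen 2 \<in> ?N c" for c :: "nat \<Rightarrow> nat" by (rule imageI)
  have "id \<circ> gen 4 \<in> ?N (hex \<circ> hex)" "hex \<circ> gen 4 \<in> ?N id" "(hex \<circ> hex) \<circ> gen 4 \<in> ?N hex"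
    using two[of "hex \<circ> hex"] two[of id] two[of hex] share[of id] share[of hex] share[of "hex \<circ> hex"]
    by (simp_all add: hex_cube h4 flip: comp_assoc)
  then have "hex_cut n \<subseteq> ?N id \<union> ?N hex \<union> ?N (hex \<circ> hex)"
    unfolding hex_cut_def by blast
  then have "card (hex_cut n) \<le> card (?N id \<union> ?N hex \<union> ?N (hex \<circ> hex))"
    by (rule card_mono[rotated]) (simp add: gens_def)
  also have "\<dots> \<le> card (?N id) + card (?N hex) + card (?N (hex \<circ> hex))"
    by (meson add_right_mono card_Un_le le_trans)
  also have "\<dots> \<le> (n - 2) + (n - 2) + (n - 2)"
  proof -
    have "card (gens n - {4}) = n - 2" "finite (gens n - {4})"
      using assms by (simp_all add: gens_def card_Diff_subset)
    then show ?thesis by (metis add_mono card_image_le)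
  qed
  finally show ?thesis by simp
qed

lemma hex_cut_subset:
  assumes "n \<ge> 4"
  shows "hex_cut n \<subseteq> even_perms n"
proof -
  have "{id, hex, hex \<circ> hex} \<subseteq> even_perms n"
    using hex_in_even_perms[OF assms] by (simp add: even_perms_comp)
  then show ?thesis using assms unfolding hex_cut_def
    by (intro UN_least image_subsetI comp_gen_in_even_perms) auto
qed

text \<open>This guarantees that the three vertices to be isolated are not deleted
  themselves.\<close>

lemma fix_1_notin_hex_cut: "c (Suc 0) = Suc 0 \<Longrightarrow> c \<notin> hex_cut n"
proof
  assume c: "c (Suc 0) = Suc 0" "c \<in> hex_cut n"
  then obtain d j where d: "d \<in> {id, hex, hex \<circ> hex}" "j \<in> gens n" "c = d \<circ> gen j"
    unfolding hex_cut_def by blast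
  have "inj hex" using even_perms_inj hex_in_even_perms by blast
  then have "inj d" "d (Suc 0) = Suc 0" using d(1) by (auto simp: hex_apply inj_compose)
  then have "gen j (Suc 0) = Suc 0" using c(1) d(3) by (metis comp_apply injD)
  then show False using gen_1_neq[of j] d(2) by (simp add: gens_def)
qed

text \<open>There is a vertex for each of the n(n - 1) ordered pairs of distinct entries at
  positions n and 3. The bound leaves a vertex beyond the cut and the isolated vertices, and
  excludes that a small cut leaves fewer than four vertices.\<close>

lemma card_even_perms:
  assumes "n \<ge> 4"
  shows "3 * n \<le> card (even_perms n)"
proof -
  let ?P = "{1..n} \<times> {1..n} - (\<lambda>i. (i, i)) ` {1..n}"
  have "card ?P = n * n - n"
    by (subst card_Diff_subset) (auto simp: card_image inj_on_def)
  moreover have "card ?P * block_bound n \<le> card {p \<in> even_perms n. (p n, p 3) \<in> ?P}"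
    by (rule card_UN_block[OF assms]) auto
  moreover have "card {p \<in> even_perms n. (p n, p 3) \<in> ?P} \<le> card (even_perms n)"
    by (rule card_mono) auto
  moreover have "3 * n \<le> n * n - n"
    using mult_le_mono1[OF assms, of n] by linarith
  moreover have "1 \<le> block_bound n" by (simp add: block_bound_def)
  then have "card ?P \<le> card ?P * block_bound n" by simp
  ultimately show ?thesis by linarith
qed

lemma hex_cut_components:
  fixes n :: nat
  assumes n: "n \<ge> 4"
  defines "H \<equiv> with_proj (AN n) \<restriction> (even_perms n - hex_cut n)"
  shows "4 \<le> card (pre_digraph.sccs H) \<and> \<not> Digraph_Component.connected H"
proof -
  \<comment> \<open>The three isolated vertices get private colours, and all remaining vertices
    share a fourth.\<close>
  define f :: "(nat \<Rightarrow> nat) \<Rightarrow> nat" where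
    "f p = (if p = id then 0 else if p = hex then 1 else if p = hex \<circ> hex then 2 else 3)" for p
  let ?C = "{id, hex, hex \<circ> hex}"
  let ?V = "even_perms n - hex_cut n"
  have isolated: "p \<circ> gen j \<in> hex_cut n" if "p \<in> ?C" "j \<in> gens n" for p j
    using that unfolding hex_cut_def by blast
  have into_C: "p \<in> hex_cut n" if p: "p \<circ> gen j \<in> ?C" "j \<in> gens n" for p j
  proof -
    \<comment> \<open>The two rotations are inverse to each other and the other generators are
      involutions, so neighbourhoods are symmetric.\<close>
    have "gen j \<circ> gen (Transposition.transpose 1 2 j) = id"
      using p(2) by (intro ext) (auto simp: gen_def gens_def Transposition.transpose_def)
    then have "p = (p \<circ> gen j) \<circ> gen (Transposition.transpose 1 2 j)"
      by (metis comp_assoc comp_id)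
    moreover have "Transposition.transpose 1 2 j \<in> gens n"
      using p(2) n by (auto simp: gens_def Transposition.transpose_def)
    ultimately show ?thesis using isolated[OF p(1)] by metis
  qed
  have loc: "locally_constant n (hex_cut n) f"
    unfolding locally_constant_def
  proof (intro ballI impI)
    fix p j assume p: "p \<in> ?V" and j: "j \<in> gens n" "p \<circ> gen j \<notin> hex_cut n"
    have "p \<notin> ?C" using isolated[of p j] j by blast
    moreover have "p \<circ> gen j \<notin> ?C" using into_C[of p j] j p by blast
    ultimately show "f (p \<circ> gen j) = f p" by (simp add: f_def)
  qed
  have V: "id \<in> ?V" "hex \<in> ?V" "hex \<circ> hex \<in> ?V"
    using hex_in_even_perms[OF n] by (simp_all add: fix_1_notin_hex_cut hex_apply even_perms_comp)
  have "hex 3 \<noteq> id 3" "(hex \<circ> hex) 3 \<noteq> id 3" "(hex \<circ> hex) 3 \<noteq> hex 3"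
    by (simp_all add: hex_apply)
  then have neq: "hex \<noteq> id" "hex \<circ> hex \<noteq> id" "hex \<circ> hex \<noteq> hex" by metis+
  have "card (hex_cut n \<union> ?C) < card (even_perms n)"
  proof -
    have "card (hex_cut n \<union> ?C) \<le> card (hex_cut n) + card ?C" by (rule card_Un_le)
    moreover have "card ?C \<le> 3" by (simp add: card_insert_if)
    ultimately show ?thesis using card_hex_cut[OF n] card_even_perms[OF n] n by linarith
  qed
  then have "\<not> even_perms n \<subseteq> hex_cut n \<union> ?C"
    by (metis card_mono finite_UnI finite_even_perms finite.emptyI finite.insertI finite_subset
        hex_cut_subset n not_le)
  then obtain d where d: "d \<in> ?V" "d \<notin> ?C" by blast
  have vals: "f id = 0" "f hex = 1" "f (hex \<circ> hex) = 2" "f d = 3"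
    using neq d(2) by (auto simp: f_def)
  have "{0, 1, 2, 3} \<subseteq> f ` ?V"
    using imageI[OF V(1), of f] imageI[OF V(2), of f] imageI[OF V(3), of f] imageI[OF d(1), of f]
    unfolding vals by blast
  then have "card {0, 1, 2, 3::nat} \<le> card (f ` ?V)" by (rule card_mono[rotated]) simp
  then have "4 \<le> card (f ` ?V)" by simp
  moreover have "card (f ` ?V) \<le> card (pre_digraph.sccs H)"
    unfolding H_def using card_colours_le_sccs[OF _ loc] n by simp
  moreover have "\<not> Digraph_Component.connected H"
    unfolding H_def using connected_imp_constant[OF _ loc _ V(1,2)] n vals(1,2) by auto
  ultimately show ?thesis by linarith
qed

section \<open>The lower bound from colourings meets the upper bound from the hexagon cut\<close>

theorem theorem1:
  fixes n :: nat
  assumes "n \<ge> 4"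
  shows "component_connectivity 4 (with_proj (AN n)) = 3 * n - 6"
proof -
  have V: "verts (with_proj (AN n)) = even_perms n" by (simp add: AN_def)
  have n3: "n \<ge> 3" using assms by simp
  define P where "P k \<longleftrightarrow> (\<exists>S. S \<subseteq> even_perms n \<and> finite S \<and> card S = k \<and>
      (\<not> Digraph_Component.connected (with_proj (AN n) \<restriction> (even_perms n - S)) \<and>
         4 \<le> card (pre_digraph.sccs (with_proj (AN n) \<restriction> (even_perms n - S))) \<or>
       card (verts (with_proj (AN n) \<restriction> (even_perms n - S))) < 4))" for k
  have lower: "3 * n - 6 \<le> k" if Pk: "P k" for k
  proof (rule ccontr)
    assume "\<not> 3 * n - 6 \<le> k"
    obtain S where S: "S \<subseteq> even_perms n" "card S = k"
      and alt: "4 \<le> card (pre_digraph.sccs (with_proj (AN n) \<restriction> (even_perms n - S))) \<or>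
        card (even_perms n - S) < 4"
      using Pk unfolding P_def by auto
    have le: "card S \<le> 3 * n - 7" using S \<open>\<not> 3 * n - 6 \<le> k\<close> by linarith
    have "card (pre_digraph.sccs (with_proj (AN n) \<restriction> (even_perms n - S))) \<le> 3"
      using colour_bound[OF assms S(1) scc_of_locally_constant[OF n3]] le
      unfolding card_sccs_AN[OF n3] colour_bound_def by blast
    moreover have "card (even_perms n - S) = card (even_perms n) - card S"
      using S(1) by (intro card_Diff_subset) (auto intro: finite_subset)
    \<comment> \<open>Deleting at most 3n - 7 of at least 3n vertices leaves at least 7, so the
      second alternative fails as well.\<close>
    ultimately show False using alt card_even_perms[OF assms] le assms by linarith
  qed
  have "P (card (hex_cut n))"
    unfolding P_def using hex_cut_subset[OF assms] hex_cut_components[OF assms]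
    by (intro exI[of _ "hex_cut n"]) (auto intro: finite_subset)
  moreover from this have "card (hex_cut n) = 3 * n - 6"
    using lower card_hex_cut[OF assms] by (intro antisym)
  ultimately have "(LEAST k. P k) = 3 * n - 6"
    using lower by (intro Least_equality) simp_all
  then show ?thesis unfolding component_connectivity_def V P_def .
qed

end
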